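(* Let $(c,\vec u,p)$ be a sufficiently smooth solution of the incompressible Navier--Stokes/Cahn--Hilliard system with artificial compressibility (without gravity) $$c_t+\nabla\cdot(c\vec u)=M_0\nabla^2\mu,\qquad \mu=f_0'(c)-\tfrac32\sigma\varepsilon\nabla^2c,$$ $$\sqrt\rho\,(\sqrt\rho\,\vec u)_t+\nabla\cdot\left(\tfrac12\rho\,\vec u\,\vec u\right)+\tfrac12\rho\,\vec u\cdot\nabla\vec u+c\nabla\mu=-\nabla p+\nabla\cdot\left(2\eta\,\mathsf S\right),$$ $$p_t+\rho_0c_0^2\,\nabla\cdot\vec u=0 .$$ Then the entropy $$\mathcal E=f_0(c)+\tfrac34\sigma\varepsilon|\nabla c|^2+\tfrac12\rho|\vec u|^2+\frac{p^2}{2\rho_0c_0^2}\ \geq 0$$ satisfies the local balance law $$\mathcal E_t+\nabla\cdot\vec f^{\,\mathcal E}=-M_0|\nabla\mu|^2-2\eta\,\mathsf S:\mathsf S\ \leq 0,$$ with entropy flux $$\vec f^{\,\mathcal E}=-\tfrac32\sigma\varepsilon\,c_t\nabla c+\left(\tfrac12\rho|\vec u|^2+p+\mu c\right)\vec u-2\eta\,\mathsf S\cdot\vec u-M_0\,\mu\nabla\mu .$$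
   Context: The unknowns are the concentration $c(\vec x,t)$, the velocity $\vec u(\vec x,t)\in\mathbb R^3$ and the (auxiliary) pressure $p(\vec x,t)$, $\vec x\in\Omega\subset\mathbb R^3$. The constants $\sigma,\varepsilon,M_0,\rho_1,\rho_2,\eta_1,\eta_2,c_0$ are positive, and $\rho_0=\max(\rho_1,\rho_2)$. The chemical free energy is $f_0(c)=\frac{12\sigma}{\varepsilon}c^2(1-c)^2$. The density is $\rho=\rho_1\hat c+\rho_2(1-\hat c)$ with the cutoff $\hat c=\min(\max(c,0),1)$, so $\rho>0$. The viscosity is $\eta=\eta_1c+\eta_2(1-c)$, assumed non-negative. $\mathsf S=\frac12(\nabla\vec u+\nabla\vec u^T)$ is the strain tensor; $\nabla\cdot(\frac12\rho\vec u\vec u)$ has $i$-th component $\nabla\cdot(\frac12\rho u_i\vec u)$ and $\vec u\cdot\nabla\vec u$ has $i$-th component $\vec u\cdot\nabla u_i$. Subscript $t$ denotes the time derivative. *)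

theory Defs
  imports "HOL-Analysis.Analysis"
begin

text \<open>Scalar fields have type \<open>real^3 \<Rightarrow> real \<Rightarrow> real\<close> and vector fields type
  \<open>real^3 \<Rightarrow> real \<Rightarrow> real^3\<close>; the first argument is the position, the second the time.\<close>

section \<open>Differential operators\<close>

definition grad :: "(real^3 \<Rightarrow> real) \<Rightarrow> real^3 \<Rightarrow> real^3" where
  "grad f x = (\<chi> i. frechet_derivative f (at x) (axis i 1))"

definition divergence :: "(real^3 \<Rightarrow> real^3) \<Rightarrow> real^3 \<Rightarrow> real" where
  "divergence F x = (\<Sum>i\<in>UNIV. frechet_derivative (\<lambda>y. F y $ i) (at x) (axis i 1))"

definition laplacian :: "(real^3 \<Rightarrow> real) \<Rightarrow> real^3 \<Rightarrow> real" where
  "laplacian f x = divergence (grad f) x"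

definition tensor_divergence :: "(real^3 \<Rightarrow> real^3^3) \<Rightarrow> real^3 \<Rightarrow> real^3" where
  "tensor_divergence A x = (\<chi> i. divergence (\<lambda>y. A y $ i) x)"

definition strain :: "(real^3 \<Rightarrow> real^3) \<Rightarrow> real^3 \<Rightarrow> real^3^3" where
  "strain v x = (1/2) *\<^sub>R (jacobian v (at x) + transpose (jacobian v (at x)))"

definition time_deriv :: "(real^3 \<Rightarrow> real \<Rightarrow> 'b::real_normed_vector) \<Rightarrow> real^3 \<Rightarrow> real \<Rightarrow> 'b" where
  "time_deriv f x t = vector_derivative (\<lambda>s. f x s) (at t)"

text \<open>\<open>k\<close> times continuously differentiable. Two-sided derivatives are used, so this is the
  usual notion on open sets.\<close>

primrec Ck_on :: "nat \<Rightarrow> 'a::real_normed_vector set \<Rightarrow> ('a \<Rightarrow> 'b::real_normed_vector) \<Rightarrow> bool" where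
  "Ck_on 0 S f \<longleftrightarrow> continuous_on S f"
| "Ck_on (Suc k) S f \<longleftrightarrow> (\<forall>x\<in>S. f differentiable (at x)) \<and>
     (\<forall>v. Ck_on k S (\<lambda>x. frechet_derivative f (at x) v))"

section \<open>Constitutive relations\<close>

definition free_energy :: "real \<Rightarrow> real \<Rightarrow> real \<Rightarrow> real" where
  "free_energy \<sigma> \<epsilon> c = 12 * \<sigma> / \<epsilon> * c\<^sup>2 * (1 - c)\<^sup>2"

definition cutoff :: "real \<Rightarrow> real" where
  "cutoff c = min (max c 0) 1"

definition density :: "real \<Rightarrow> real \<Rightarrow> real \<Rightarrow> real" where
  "density \<rho>1 \<rho>2 c = \<rho>1 * cutoff c + \<rho>2 * (1 - cutoff c)"

definition viscosity :: "real \<Rightarrow> real \<Rightarrow> real \<Rightarrow> real" where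
  "viscosity \<eta>1 \<eta>2 c = \<eta>1 * c + \<eta>2 * (1 - c)"

definition chem_potential ::
    "real \<Rightarrow> real \<Rightarrow> (real^3 \<Rightarrow> real \<Rightarrow> real) \<Rightarrow> real^3 \<Rightarrow> real \<Rightarrow> real" where
  "chem_potential \<sigma> \<epsilon> c x t =
     deriv (free_energy \<sigma> \<epsilon>) (c x t) - 3/2 * \<sigma> * \<epsilon> * laplacian (\<lambda>y. c y t) x"

section \<open>The system\<close>

text \<open>The cutoff makes the density a merely Lipschitz function of the concentration, so
  smoothness of \<open>c\<close> and \<open>u\<close> does not imply that the two terms of the momentum equation in
  which the density is differentiated exist classically where \<open>c\<close> crosses 0 or 1. The last
  two conditions require this (they follow from smoothness of \<open>c\<close> and \<open>u\<close> in space and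
  time wherever \<open>0 < c < 1\<close>).\<close>

definition sufficiently_smooth ::
    "real \<Rightarrow> real \<Rightarrow> (real^3) set \<Rightarrow> real set \<Rightarrow> (real^3 \<Rightarrow> real \<Rightarrow> real) \<Rightarrow>
     (real^3 \<Rightarrow> real \<Rightarrow> real^3) \<Rightarrow> (real^3 \<Rightarrow> real \<Rightarrow> real) \<Rightarrow> bool" where
  "sufficiently_smooth \<rho>1 \<rho>2 \<Omega> T c u p \<longleftrightarrow>
     Ck_on 2 (\<Omega> \<times> T) (\<lambda>(x, t). c x t) \<and>
     (\<forall>t\<in>T. Ck_on 4 \<Omega> (\<lambda>x. c x t)) \<and>
     (\<forall>t\<in>T. Ck_on 2 \<Omega> (\<lambda>x. u x t)) \<and>
     (\<forall>x\<in>\<Omega>. \<forall>t\<in>T. (\<lambda>y. p y t) differentiable (at x) \<and> (\<lambda>s. p x s) differentiable (at t)) \<and>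
     (\<forall>x\<in>\<Omega>. \<forall>t\<in>T. (\<lambda>s. sqrt (density \<rho>1 \<rho>2 (c x s)) *\<^sub>R u x s) differentiable (at t)) \<and>
     (\<forall>x\<in>\<Omega>. \<forall>t\<in>T. \<forall>i.
        (\<lambda>y. (density \<rho>1 \<rho>2 (c y t) * u y t $ i) *\<^sub>R u y t) differentiable (at x))"

definition NSCH_solution ::
    "real \<Rightarrow> real \<Rightarrow> real \<Rightarrow> real \<Rightarrow> real \<Rightarrow> real \<Rightarrow> real \<Rightarrow> real \<Rightarrow> (real^3) set \<Rightarrow> real set \<Rightarrow>
     (real^3 \<Rightarrow> real \<Rightarrow> real) \<Rightarrow> (real^3 \<Rightarrow> real \<Rightarrow> real^3) \<Rightarrow> (real^3 \<Rightarrow> real \<Rightarrow> real) \<Rightarrow> bool" where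
  "NSCH_solution \<sigma> \<epsilon> M0 \<rho>1 \<rho>2 \<eta>1 \<eta>2 c0 \<Omega> T c u p \<longleftrightarrow>
    (let \<mu> = chem_potential \<sigma> \<epsilon> c;
         \<rho> = (\<lambda>x t. density \<rho>1 \<rho>2 (c x t));
         \<eta> = (\<lambda>x t. viscosity \<eta>1 \<eta>2 (c x t));
         \<rho>0 = max \<rho>1 \<rho>2
     in \<forall>x\<in>\<Omega>. \<forall>t\<in>T.
       time_deriv c x t + divergence (\<lambda>y. c y t *\<^sub>R u y t) x = M0 * laplacian (\<lambda>y. \<mu> y t) x \<and>
       sqrt (\<rho> x t) *\<^sub>R time_deriv (\<lambda>y s. sqrt (\<rho> y s) *\<^sub>R u y s) x t
         + (\<chi> i. divergence (\<lambda>y. (1/2 * \<rho> y t * u y t $ i) *\<^sub>R u y t) x)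
         + (1/2 * \<rho> x t) *\<^sub>R (\<chi> i. u x t \<bullet> grad (\<lambda>y. u y t $ i) x)
         + c x t *\<^sub>R grad (\<lambda>y. \<mu> y t) x
       = - grad (\<lambda>y. p y t) x
         + tensor_divergence (\<lambda>y. (2 * \<eta> y t) *\<^sub>R strain (\<lambda>z. u z t) y) x \<and>
       time_deriv p x t + \<rho>0 * c0\<^sup>2 * divergence (\<lambda>y. u y t) x = 0)"

section \<open>Entropy and entropy flux\<close>

definition entropy ::
    "real \<Rightarrow> real \<Rightarrow> real \<Rightarrow> real \<Rightarrow> real \<Rightarrow> (real^3 \<Rightarrow> real \<Rightarrow> real) \<Rightarrow>
     (real^3 \<Rightarrow> real \<Rightarrow> real^3) \<Rightarrow> (real^3 \<Rightarrow> real \<Rightarrow> real) \<Rightarrow> real^3 \<Rightarrow> real \<Rightarrow> real" where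
  "entropy \<sigma> \<epsilon> \<rho>1 \<rho>2 c0 c u p x t =
     free_energy \<sigma> \<epsilon> (c x t)
     + 3/4 * \<sigma> * \<epsilon> * (norm (grad (\<lambda>y. c y t) x))\<^sup>2
     + 1/2 * density \<rho>1 \<rho>2 (c x t) * (norm (u x t))\<^sup>2
     + (p x t)\<^sup>2 / (2 * max \<rho>1 \<rho>2 * c0\<^sup>2)"

definition entropy_flux ::
    "real \<Rightarrow> real \<Rightarrow> real \<Rightarrow> real \<Rightarrow> real \<Rightarrow> real \<Rightarrow> real \<Rightarrow> (real^3 \<Rightarrow> real \<Rightarrow> real) \<Rightarrow>
     (real^3 \<Rightarrow> real \<Rightarrow> real^3) \<Rightarrow> (real^3 \<Rightarrow> real \<Rightarrow> real) \<Rightarrow> real^3 \<Rightarrow> real \<Rightarrow> real^3" where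
  "entropy_flux \<sigma> \<epsilon> M0 \<rho>1 \<rho>2 \<eta>1 \<eta>2 c u p x t =
    (let \<mu> = chem_potential \<sigma> \<epsilon> c in
      - ((3/2 * \<sigma> * \<epsilon> * time_deriv c x t) *\<^sub>R grad (\<lambda>y. c y t) x)
      + (1/2 * density \<rho>1 \<rho>2 (c x t) * (norm (u x t))\<^sup>2 + p x t + \<mu> x t * c x t) *\<^sub>R u x t
      - (2 * viscosity \<eta>1 \<eta>2 (c x t)) *\<^sub>R (strain (\<lambda>y. u y t) x *v u x t)
      - (M0 * \<mu> x t) *\<^sub>R grad (\<lambda>y. \<mu> y t) x)"

text \<open>The contraction \<open>S : S\<close> is the inner product of \<open>real^3^3\<close>, i.e. the sum of the
  products of corresponding entries.\<close>

definition entropy_production ::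
    "real \<Rightarrow> real \<Rightarrow> real \<Rightarrow> real \<Rightarrow> real \<Rightarrow> (real^3 \<Rightarrow> real \<Rightarrow> real) \<Rightarrow>
     (real^3 \<Rightarrow> real \<Rightarrow> real^3) \<Rightarrow> real^3 \<Rightarrow> real \<Rightarrow> real" where
  "entropy_production \<sigma> \<epsilon> M0 \<eta>1 \<eta>2 c u x t =
     - M0 * (norm (grad (\<lambda>y. chem_potential \<sigma> \<epsilon> c y t) x))\<^sup>2
     - 2 * viscosity \<eta>1 \<eta>2 (c x t) * (strain (\<lambda>y. u y t) x \<bullet> strain (\<lambda>y. u y t) x)"

end

theory Submission
  imports Defs
begin

text \<open>The time derivative of the entropy and the divergence of the flux are expanded by the
  product rule. The free-energy terms combine to \<open>\<mu> c\<^sub>t\<close>, because the time derivative commutes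
  with the gradient of \<open>c\<close>. What remains is \<open>\<mu>\<close> times the mass equation, \<open>u\<close> times the momentum
  equation, \<open>p / (\<rho>\<^sub>0 c\<^sub>0\<^sup>2)\<close> times the pressure equation, and the production; here
  \<open>\<nabla>u : S = S : S\<close> by symmetry of \<open>S\<close>. The density, which is only Lipschitz in \<open>c\<close>, is never
  differentiated by itself: the kinetic energy is half the square of \<open>\<surd>\<rho> u\<close>, and its flux is the
  sum over \<open>i\<close> of \<open>u\<^sub>i\<close> times \<open>\<rho> u\<^sub>i u / 2\<close>, whose factors are differentiable.\<close>

section \<open>Derivatives and smooth functions\<close>

lemma frechet_derivative_add:
  assumes "f differentiable (at x)" and "g differentiable (at x)"
  shows "frechet_derivative (\<lambda>x. f x + g x) (at x) v
       = frechet_derivative f (at x) v + frechet_derivative g (at x) v"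
  by (rule fun_cong[OF frechet_derivative_at, symmetric],
      rule has_derivative_add[OF assms[unfolded frechet_derivative_works]])

lemma frechet_derivative_diff:
  assumes "f differentiable (at x)" and "g differentiable (at x)"
  shows "frechet_derivative (\<lambda>x. f x - g x) (at x) v
       = frechet_derivative f (at x) v - frechet_derivative g (at x) v"
  by (rule fun_cong[OF frechet_derivative_at, symmetric],
      rule has_derivative_diff[OF assms[unfolded frechet_derivative_works]])

lemma frechet_derivative_minus:
  assumes "f differentiable (at x)"
  shows "frechet_derivative (\<lambda>x. - f x) (at x) v = - frechet_derivative f (at x) v"
  by (rule fun_cong[OF frechet_derivative_at, symmetric],
      rule has_derivative_minus[OF assms[unfolded frechet_derivative_works]])

lemma frechet_derivative_mult:
  fixes f g :: "'a::real_normed_vector \<Rightarrow> 'b::real_normed_algebra"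
  assumes "f differentiable (at x)" and "g differentiable (at x)"
  shows "frechet_derivative (\<lambda>x. f x * g x) (at x) v
       = f x * frechet_derivative g (at x) v + frechet_derivative f (at x) v * g x"
  by (rule fun_cong[OF frechet_derivative_at, symmetric],
      rule has_derivative_mult[OF assms[unfolded frechet_derivative_works]])

text \<open>\<open>Ck_on\<close> asks for continuity only at the last level. Differentiability at
  every point of \<open>S\<close> supplies it one level earlier, and the induction passes this down
  through the directional derivatives.\<close>

lemma Ck_on_SucD: "Ck_on (Suc k) S f \<Longrightarrow> Ck_on k S f"
proof (induction k arbitrary: f)
  case 0
  then show ?case
    by (auto intro!: continuous_at_imp_continuous_on differentiable_imp_continuous_within)
next
  case (Suc k)
  then have "\<forall>x\<in>S. f differentiable (at x)"
    and "Ck_on (Suc k) S (\<lambda>x. frechet_derivative f (at x) v)" for v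
    unfolding Ck_on.simps(2)[of "Suc k"] by blast+
  then show ?case using Suc.IH unfolding Ck_on.simps(2)[of k] by blast
qed

text \<open>On an open set the values on \<open>S\<close> determine the derivatives there. This lets
  sum and product rules, valid only where the functions are differentiable, be used inside
  \<open>Ck_on\<close> although nothing is known outside \<open>S\<close>.\<close>

lemma Ck_on_cong:
  assumes "open S" and "\<And>x. x \<in> S \<Longrightarrow> f x = g x" and "Ck_on k S f"
  shows "Ck_on k S g"
  using assms(2,3)
proof (induction k arbitrary: f g)
  case 0
  then show ?case using continuous_on_cong[of S S f g] by simp
next
  case (Suc k)
  have diff: "f differentiable (at x)" if "x \<in> S" for x
    using Suc.prems that by simp
  have eq: "frechet_derivative f (at x) v = frechet_derivative g (at x) v" if "x \<in> S" for x v
    using frechet_derivative_transform_within_open[OF diff[OF that] assms(1) that Suc.prems(1)]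
    by simp
  have "Ck_on k S (\<lambda>x. frechet_derivative f (at x) v)" for v
    using Suc.prems(2) by simp
  then have "Ck_on k S (\<lambda>x. frechet_derivative g (at x) v)" for v
    by (rule Suc.IH[rotated]) (rule eq)
  moreover have "g differentiable (at x)" if "x \<in> S" for x
    using has_derivative_transform_within_open
      [OF diff[OF that, unfolded frechet_derivative_works] assms(1) that Suc.prems(1)]
    by (rule differentiableI)
  ultimately show ?case by simp
qed

lemma Ck_on_const: "Ck_on k S (\<lambda>x. a)"
  by (induction k arbitrary: a) auto

lemma Ck_on_add:
  assumes "open S" and "Ck_on k S f" and "Ck_on k S g"
  shows "Ck_on k S (\<lambda>x. f x + g x)"
  using assms(2,3)
proof (induction k arbitrary: f g)
  case 0
  then show ?case by (simp add: continuous_on_add)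
next
  case (Suc k)
  have eq: "frechet_derivative f (at x) v + frechet_derivative g (at x) v
      = frechet_derivative (\<lambda>x. f x + g x) (at x) v" if "x \<in> S" for x v
    using Suc.prems that
    by (simp add: frechet_derivative_add)
  have "Ck_on k S (\<lambda>x. frechet_derivative f (at x) v + frechet_derivative g (at x) v)" for v
    using Suc.prems by (intro Suc.IH) simp_all
  then have "Ck_on k S (\<lambda>x. frechet_derivative (\<lambda>x. f x + g x) (at x) v)" for v
    by (rule Ck_on_cong[OF assms(1), rotated]) (rule eq)
  then show ?case using Suc.prems by simp
qed

text \<open>The product rule yields products of a derivative with an undifferentiated factor;
  \<open>Ck_on_SucD\<close> lowers the order of the latter so that the induction hypothesis applies
  to both.\<close>

lemma Ck_on_mult:
  fixes f g :: "'a::real_normed_vector \<Rightarrow> 'b::real_normed_algebra"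
  assumes "open S" and "Ck_on k S f" and "Ck_on k S g"
  shows "Ck_on k S (\<lambda>x. f x * g x)"
  using assms(2,3)
proof (induction k arbitrary: f g)
  case 0
  then show ?case by (simp add: continuous_on_mult)
next
  case (Suc k)
  have eq: "f x * frechet_derivative g (at x) v + frechet_derivative f (at x) v * g x
      = frechet_derivative (\<lambda>x. f x * g x) (at x) v" if "x \<in> S" for x v
    using Suc.prems that
    by (simp add: frechet_derivative_mult)
  have "Ck_on k S (\<lambda>x. f x * frechet_derivative g (at x) v
      + frechet_derivative f (at x) v * g x)" for v
    using Suc.prems Ck_on_SucD[OF Suc.prems(1)] Ck_on_SucD[OF Suc.prems(2)]
    by (intro Ck_on_add[OF assms(1)] Suc.IH) simp_all
  then have "Ck_on k S (\<lambda>x. frechet_derivative (\<lambda>x. f x * g x) (at x) v)" for v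
    by (rule Ck_on_cong[OF assms(1), rotated]) (rule eq)
  then show ?case using Suc.prems by simp
qed

lemma Ck_on_sum:
  assumes "open S" and "\<And>i. i \<in> I \<Longrightarrow> Ck_on k S (f i)"
  shows "Ck_on k S (\<lambda>x. \<Sum>i\<in>I. f i x)"
  using assms(2)
  by (induction I rule: infinite_finite_induct) (auto simp: Ck_on_const intro!: Ck_on_add[OF assms(1)])

section \<open>Symmetry of second derivatives\<close>

text \<open>The chain rule along a line, which makes the one-variable mean value theorem available
  for \<open>f\<close>.\<close>

lemma DERIV_frechet_line:
  fixes f :: "'a::real_normed_vector \<Rightarrow> real"
  assumes "f differentiable (at (z + r *\<^sub>R a))"
  shows "((\<lambda>r. f (z + r *\<^sub>R a)) has_real_derivative
    frechet_derivative f (at (z + r *\<^sub>R a)) a) (at r)"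
proof -
  have line: "((\<lambda>r. z + r *\<^sub>R a) has_derivative (\<lambda>h. h *\<^sub>R a)) (at r)"
    by (auto intro!: derivative_eq_intros)
  have "(f has_derivative frechet_derivative f (at (z + r *\<^sub>R a))) (at (z + r *\<^sub>R a))"
    using assms by (simp add: frechet_derivative_works)
  from diff_chain_at[OF line this] show ?thesis
    using linear_frechet_derivative[OF assms]
    by (simp add: o_def linear_cmul has_field_derivative_def mult.commute[of _ "frechet_derivative f _ a"])
qed

text \<open>Two mean value steps: first along \<open>a\<close>, for the difference of
  \<open>f\<close> on two opposite sides of the parallelogram; then along \<open>b\<close>, for the
  derivative of \<open>f\<close> in direction \<open>a\<close>. The assumption \<open>box\<close>
  keeps all points used inside \<open>U\<close>.\<close>

lemma second_difference_mvt:
  fixes f :: "'a::real_normed_vector \<Rightarrow> real"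
  assumes "0 < s"
    and box: "\<And>\<xi> \<zeta>. 0 \<le> \<xi> \<Longrightarrow> \<xi> \<le> s \<Longrightarrow> 0 \<le> \<zeta> \<Longrightarrow> \<zeta> \<le> s \<Longrightarrow> z + \<xi> *\<^sub>R a + \<zeta> *\<^sub>R b \<in> U"
    and f: "\<And>w. w \<in> U \<Longrightarrow> f differentiable (at w)"
    and Da: "\<And>w. w \<in> U \<Longrightarrow> (\<lambda>w. frechet_derivative f (at w) a) differentiable (at w)"
  obtains \<xi> \<zeta> where "0 < \<xi>" "\<xi> < s" "0 < \<zeta>" "\<zeta> < s"
    "f (z + s *\<^sub>R a + s *\<^sub>R b) - f (z + s *\<^sub>R a) - f (z + s *\<^sub>R b) + f z
      = s\<^sup>2 * frechet_derivative (\<lambda>w. frechet_derivative f (at w) a)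
                (at (z + \<xi> *\<^sub>R a + \<zeta> *\<^sub>R b)) b"
proof -
  let ?D = "\<lambda>w. frechet_derivative f (at w) a"
  let ?\<phi> = "\<lambda>r. f ((z + s *\<^sub>R b) + r *\<^sub>R a) - f (z + r *\<^sub>R a)"
  have "(?\<phi> has_real_derivative ?D ((z + s *\<^sub>R b) + r *\<^sub>R a) - ?D (z + r *\<^sub>R a)) (at r)"
    if "0 \<le> r" "r \<le> s" for r
    using that \<open>0 < s\<close> box[of r s] box[of r 0]
    by (intro DERIV_diff DERIV_frechet_line f) (simp_all add: algebra_simps)
  from MVT2[OF \<open>0 < s\<close> this] obtain \<xi> where \<xi>: "0 < \<xi>" "\<xi> < s"
    and 1: "?\<phi> s - ?\<phi> 0 = s * (?D ((z + s *\<^sub>R b) + \<xi> *\<^sub>R a) - ?D (z + \<xi> *\<^sub>R a))"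
    by auto
  have "((\<lambda>r. ?D ((z + \<xi> *\<^sub>R a) + r *\<^sub>R b)) has_real_derivative
      frechet_derivative ?D (at (z + \<xi> *\<^sub>R a + r *\<^sub>R b)) b) (at r)"
    if "0 \<le> r" "r \<le> s" for r
    using that \<xi> box[of \<xi> r] by (intro DERIV_frechet_line Da) simp_all
  from MVT2[OF \<open>0 < s\<close> this] obtain \<zeta> where \<zeta>: "0 < \<zeta>" "\<zeta> < s"
    and 2: "?D ((z + \<xi> *\<^sub>R a) + s *\<^sub>R b) - ?D (z + \<xi> *\<^sub>R a)
      = s * frechet_derivative ?D (at (z + \<xi> *\<^sub>R a + \<zeta> *\<^sub>R b)) b"
    by auto
  have "f (z + s *\<^sub>R a + s *\<^sub>R b) - f (z + s *\<^sub>R a) - f (z + s *\<^sub>R b) + f z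
      = s * (s * frechet_derivative ?D (at (z + \<xi> *\<^sub>R a + \<zeta> *\<^sub>R b)) b)"
    using 1 unfolding 2[symmetric] by (simp add: algebra_simps)
  then show ?thesis using \<xi> \<zeta> that by (simp add: power2_eq_square mult.assoc)
qed

text \<open>The second difference of \<open>f\<close> along \<open>a\<close> and \<open>b\<close> is symmetric in \<open>a\<close> and \<open>b\<close>; the mean value
  theorem expresses it through either mixed derivative at a point near \<open>z\<close>.\<close>

lemma Ck_on_2_symmetric:
  fixes f :: "'a::real_normed_vector \<Rightarrow> real"
  assumes "open U" and "Ck_on 2 U f" and "z \<in> U"
  shows "frechet_derivative (\<lambda>w. frechet_derivative f (at w) a) (at z) b
       = frechet_derivative (\<lambda>w. frechet_derivative f (at w) b) (at z) a"
proof -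
  let ?H = "\<lambda>a b z. frechet_derivative (\<lambda>w. frechet_derivative f (at w) a) (at z) b"
  have f: "f differentiable (at w)" if "w \<in> U" for w
    using assms(2) that by (simp add: numeral_2_eq_2)
  have D: "(\<lambda>w. frechet_derivative f (at w) a) differentiable (at w)" if "w \<in> U" for a w
    using assms(2) that by (simp add: numeral_2_eq_2)
  have H: "isCont (?H a b) z" for a b
    using assms by (simp add: numeral_2_eq_2 continuous_on_eq_continuous_at)
  \<comment> \<open>It suffices to bound the gap by every positive \<open>e\<close>: each mixed
    derivative contributes \<open>e/2\<close> by continuity at \<open>z\<close>, once both are
    compared at nearby points where they agree.\<close>
  have "\<bar>?H a b z - ?H b a z\<bar> < e" if "0 < e" for e
  proof -
    obtain d1 where d1: "0 < d1" "\<And>w. dist w z < d1 \<Longrightarrow> dist (?H a b w) (?H a b z) < e/2"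
      using H[of a b] \<open>0 < e\<close> unfolding continuous_at_eps_delta by (meson half_gt_zero)
    obtain d2 where d2: "0 < d2" "\<And>w. dist w z < d2 \<Longrightarrow> dist (?H b a w) (?H b a z) < e/2"
      using H[of b a] \<open>0 < e\<close> unfolding continuous_at_eps_delta by (meson half_gt_zero)
    obtain d3 where d3: "0 < d3" "\<And>w. dist w z < d3 \<Longrightarrow> w \<in> U"
      using \<open>open U\<close> \<open>z \<in> U\<close> unfolding open_dist by blast
    define d where "d = min d1 (min d2 d3)"
    \<comment> \<open>The side length \<open>s\<close> puts the whole parallelogram within
      \<open>d / 2\<close> of \<open>z\<close>; the summand 1 keeps the denominator positive when
      \<open>a\<close> and \<open>b\<close> both vanish.\<close>
    define s where "s = d / (2 * (norm a + norm b + 1))"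
    have "0 < d" using d1 d2 d3 by (simp add: d_def)
    have pos: "0 < norm a + norm b + 1" by (simp add: add_nonneg_pos)
    have "0 < s" using \<open>0 < d\<close> pos by (simp add: s_def)
    \<comment> \<open>Only the sum of the norms matters, so one estimate serves both orders of
      \<open>a\<close> and \<open>b\<close>.\<close>
    have near: "dist (z + \<xi> *\<^sub>R a' + \<zeta> *\<^sub>R b') z < d"
      if "0 \<le> \<xi>" "\<xi> \<le> s" "0 \<le> \<zeta>" "\<zeta> \<le> s" "norm a' + norm b' = norm a + norm b" for \<xi> \<zeta> a' b'
    proof -
      have "dist (z + \<xi> *\<^sub>R a' + \<zeta> *\<^sub>R b') z \<le> \<xi> * norm a' + \<zeta> * norm b'"
        using norm_triangle_ineq[of "\<xi> *\<^sub>R a'" "\<zeta> *\<^sub>R b'"] that by (simp add: dist_norm add.assoc)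
      also have "\<dots> \<le> s * (norm a' + norm b')"
        using that unfolding distrib_left by (intro add_mono mult_right_mono) simp_all
      also have "\<dots> \<le> s * (norm a + norm b + 1)"
        using that \<open>0 < s\<close> by simp
      also have "\<dots> = d / 2" using pos unfolding s_def by (simp add: field_simps)
      also have "\<dots> < d" using \<open>0 < d\<close> by simp
      finally show ?thesis .
    qed
    have inU: "z + \<xi> *\<^sub>R a' + \<zeta> *\<^sub>R b' \<in> U"
      if "0 \<le> \<xi>" "\<xi> \<le> s" "0 \<le> \<zeta>" "\<zeta> \<le> s" "norm a' + norm b' = norm a + norm b" for \<xi> \<zeta> a' b'
      using near[OF that] d3 by (simp add: d_def)
    note box = inU[OF _ _ _ _ refl] inU[OF _ _ _ _ add.commute]
    obtain \<xi> \<zeta> where 1: "0 < \<xi>" "\<xi> < s" "0 < \<zeta>" "\<zeta> < s"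
      "f (z + s *\<^sub>R a + s *\<^sub>R b) - f (z + s *\<^sub>R a) - f (z + s *\<^sub>R b) + f z
        = s\<^sup>2 * ?H a b (z + \<xi> *\<^sub>R a + \<zeta> *\<^sub>R b)"
      by (rule second_difference_mvt[OF \<open>0 < s\<close> box(1) f D]) simp_all
    obtain \<xi>' \<zeta>' where 2: "0 < \<xi>'" "\<xi>' < s" "0 < \<zeta>'" "\<zeta>' < s"
      "f (z + s *\<^sub>R b + s *\<^sub>R a) - f (z + s *\<^sub>R b) - f (z + s *\<^sub>R a) + f z
        = s\<^sup>2 * ?H b a (z + \<xi>' *\<^sub>R b + \<zeta>' *\<^sub>R a)"
      by (rule second_difference_mvt[OF \<open>0 < s\<close> box(2) f D]) simp_all
    have "s\<^sup>2 * ?H a b (z + \<xi> *\<^sub>R a + \<zeta> *\<^sub>R b) = s\<^sup>2 * ?H b a (z + \<xi>' *\<^sub>R b + \<zeta>' *\<^sub>R a)"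
      using 1(5) 2(5) by (simp add: algebra_simps)
    then have eq: "?H a b (z + \<xi> *\<^sub>R a + \<zeta> *\<^sub>R b) = ?H b a (z + \<xi>' *\<^sub>R b + \<zeta>' *\<^sub>R a)"
      using \<open>0 < s\<close> by simp
    have "dist (?H a b (z + \<xi> *\<^sub>R a + \<zeta> *\<^sub>R b)) (?H a b z) < e/2"
      using near[of \<xi> \<zeta> a b] 1 by (intro d1) (simp add: d_def)
    moreover have "dist (?H b a (z + \<xi>' *\<^sub>R b + \<zeta>' *\<^sub>R a)) (?H b a z) < e/2"
      using near[of \<xi>' \<zeta>' b a] 2 by (intro d2) (simp add: d_def add.commute)
    ultimately show ?thesis using eq unfolding dist_real_def by linarith
  qed
  then have "\<not> 0 < \<bar>?H a b z - ?H b a z\<bar>" by blast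
  then show ?thesis by simp
qed

section \<open>Gradients and divergences\<close>

lemma differentiable_vec_nth:
  "f differentiable F \<Longrightarrow> (\<lambda>x. f x $ i) differentiable F"
  using bounded_linear.has_derivative[OF bounded_linear_vec_nth] unfolding differentiable_def by blast

lemma differentiable_cartI:
  fixes f :: "'a::real_normed_vector \<Rightarrow> real^'n"
  assumes "\<And>i. (\<lambda>x. f x $ i) differentiable (at x)"
  shows "f differentiable (at x)"
proof -
  have "f = (\<lambda>x. \<Sum>i\<in>UNIV. f x $ i *\<^sub>R axis i 1)"
    by (simp add: fun_eq_iff vec_eq_iff axis_def if_distrib cong: if_cong)
  moreover have "(\<lambda>x. \<Sum>i\<in>UNIV. f x $ i *\<^sub>R axis i (1::real)) differentiable (at x)"
    using assms by (intro differentiable_sum differentiable_scaleR) auto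
  ultimately show ?thesis by simp
qed

lemma frechet_derivative_vec_nth:
  assumes "f differentiable (at x)"
  shows "frechet_derivative (\<lambda>y. f y $ i) (at x) v = frechet_derivative f (at x) v $ i"
  by (rule fun_cong[OF frechet_derivative_at, symmetric], rule bounded_linear.has_derivative
      [OF bounded_linear_vec_nth assms[unfolded frechet_derivative_works]])

lemma divergence_add:
  assumes "F differentiable (at x)" and "G differentiable (at x)"
  shows "divergence (\<lambda>y. F y + G y) x = divergence F x + divergence G x"
  unfolding divergence_def using assms
  by (simp add: frechet_derivative_add differentiable_vec_nth sum.distrib)

lemma divergence_minus:
  assumes "F differentiable (at x)"
  shows "divergence (\<lambda>y. - F y) x = - divergence F x"
  unfolding divergence_def using assms
  by (simp add: frechet_derivative_minus differentiable_vec_nth sum_negf)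

lemma divergence_diff:
  assumes "F differentiable (at x)" and "G differentiable (at x)"
  shows "divergence (\<lambda>y. F y - G y) x = divergence F x - divergence G x"
  unfolding divergence_def using assms
  by (simp add: frechet_derivative_diff differentiable_vec_nth sum_subtractf)

lemma divergence_scaleR:
  assumes "f differentiable (at x)" and "F differentiable (at x)"
  shows "divergence (\<lambda>y. f y *\<^sub>R F y) x = f x * divergence F x + grad f x \<bullet> F x"
  unfolding divergence_def using assms
  by (simp add: frechet_derivative_mult differentiable_vec_nth sum.distrib sum_distrib_left
      grad_def inner_vec_def)

text \<open>Serves the convective and viscous fluxes, which are sums over the velocity components of
  u_i times a vector field.\<close>

lemma divergence_sum_scaleR:
  fixes I :: "'i set"
  assumes "finite I" and "\<And>i. i \<in> I \<Longrightarrow> f i differentiable (at x)"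
    and "\<And>i. i \<in> I \<Longrightarrow> F i differentiable (at x)"
  shows "divergence (\<lambda>y. \<Sum>i\<in>I. f i y *\<^sub>R F i y) x
       = (\<Sum>i\<in>I. f i x * divergence (F i) x + grad (f i) x \<bullet> F i x)"
  using assms
proof (induction I)
  case empty
  then show ?case by (simp add: divergence_def)
next
  case (insert i I)
  then show ?case by (simp add: divergence_add divergence_scaleR differentiable_sum differentiable_scaleR)
qed


section \<open>Space-time regularity\<close>

lemma spatial_slice:
  fixes F :: "'a::real_normed_vector \<times> real \<Rightarrow> 'b::real_normed_vector"
  assumes "F differentiable (at (x, t))"
  shows "((\<lambda>y. F (y, t)) has_derivative (\<lambda>h. frechet_derivative F (at (x, t)) (h, 0))) (at x)"
proof -
  have "((\<lambda>y. (y, t)) has_derivative (\<lambda>h. (h, 0))) (at x)"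
    by (intro has_derivative_Pair has_derivative_ident has_derivative_const)
  from diff_chain_at[OF this assms[unfolded frechet_derivative_works]]
  show ?thesis by (simp add: o_def)
qed

lemma temporal_slice:
  fixes F :: "'a::real_normed_vector \<times> real \<Rightarrow> 'b::real_normed_vector"
  assumes "F differentiable (at (x, t))"
  shows "((\<lambda>s. F (x, s)) has_vector_derivative frechet_derivative F (at (x, t)) (0, 1)) (at t)"
proof -
  let ?D = "frechet_derivative F (at (x, t))"
  have "((\<lambda>s. (x, s)) has_derivative (\<lambda>h. (0, h))) (at t)"
    by (intro has_derivative_Pair has_derivative_ident has_derivative_const)
  from diff_chain_at[OF this assms[unfolded frechet_derivative_works]]
  have "((\<lambda>s. F (x, s)) has_derivative (\<lambda>h. ?D (0, h))) (at t)"
    by (simp add: o_def)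
  moreover have "(\<lambda>h. ?D (0, h)) = (\<lambda>h. h *\<^sub>R ?D (0, 1))"
    by (simp flip: linear_cmul[OF linear_frechet_derivative[OF assms]])
  ultimately show ?thesis unfolding has_vector_derivative_def by (simp only:)
qed

context
  fixes \<Omega> :: "(real^3) set" and T :: "real set" and f :: "real^3 \<Rightarrow> real \<Rightarrow> real"
  assumes open_domain: "open \<Omega>" "open T" and C2: "Ck_on 2 (\<Omega> \<times> T) (\<lambda>(x, t). f x t)"
begin

private lemma joint_differentiable:
  assumes "x \<in> \<Omega>" and "t \<in> T"
  shows "(\<lambda>(x, t). f x t) differentiable (at (x, t))"
    and "(\<lambda>z. frechet_derivative (\<lambda>(x, t). f x t) (at z) v) differentiable (at (x, t))"
proof -
  have z: "(x, t) \<in> \<Omega> \<times> T" using assms by simp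
  note C2 = C2[unfolded numeral_2_eq_2 Ck_on.simps(2)]
  show "(\<lambda>(x, t). f x t) differentiable (at (x, t))"
    by (rule bspec[OF conjunct1[OF C2] z])
  show "(\<lambda>z. frechet_derivative (\<lambda>(x, t). f x t) (at z) v) differentiable (at (x, t))"
    by (rule bspec[OF conjunct1[OF spec[OF conjunct2[OF C2]]] z])
qed

lemma time_deriv_works:
  assumes "x \<in> \<Omega>" and "t \<in> T"
  shows "((\<lambda>s. f x s) has_vector_derivative time_deriv f x t) (at t)"
  using temporal_slice[OF joint_differentiable(1)[OF assms]] unfolding time_deriv_def
  by (simp add: vector_derivative_at)

text \<open>Together with \<open>grad_joint\<close> this reads both slice operators as joint
  derivatives along coordinate directions of space-time, where the symmetry of second derivatives
  applies.\<close>

private lemma time_deriv_joint: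
  assumes "x \<in> \<Omega>" and "t \<in> T"
  shows "frechet_derivative (\<lambda>(x, t). f x t) (at (x, t)) (0, 1) = time_deriv f x t"
  using temporal_slice[OF joint_differentiable(1)[OF assms]] unfolding time_deriv_def
  by (simp add: vector_derivative_at)

private lemma grad_joint:
  assumes "x \<in> \<Omega>" and "t \<in> T"
  shows "frechet_derivative (\<lambda>(x, t). f x t) (at (x, t)) (axis i 1, 0) = grad (\<lambda>y. f y t) x $ i"
  using fun_cong[OF frechet_derivative_at[OF spatial_slice[OF joint_differentiable(1)[OF assms]]],
      of "axis i 1"]
  by (simp add: grad_def)

text \<open>The identification \<open>time_deriv_joint\<close> is known only on the domain; openness
  of \<Omega> carries it over to the spatial derivative.\<close>

private lemma time_deriv_has_derivative:
  assumes "x \<in> \<Omega>" and "t \<in> T"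
  shows "((\<lambda>y. time_deriv f y t) has_derivative (\<lambda>h. frechet_derivative
    (\<lambda>z. frechet_derivative (\<lambda>(x, t). f x t) (at z) (0, 1)) (at (x, t)) (h, 0))) (at x)"
proof -
  let ?Q = "\<lambda>z. frechet_derivative (\<lambda>(x, t). f x t) (at z) (0, 1)"
  from spatial_slice[OF joint_differentiable(2)[OF assms]]
  have "((\<lambda>y. ?Q (y, t)) has_derivative (\<lambda>h. frechet_derivative ?Q (at (x, t)) (h, 0))) (at x)" .
  then show ?thesis
    by (rule has_derivative_transform_within_open[OF _ open_domain(1) assms(1)])
      (simp add: time_deriv_joint assms(2))
qed

lemma time_deriv_differentiable:
  assumes "x \<in> \<Omega>" and "t \<in> T"
  shows "(\<lambda>y. time_deriv f y t) differentiable (at x)"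
  using time_deriv_has_derivative[OF assms] by (rule differentiableI)

text \<open>Time derivative and gradient commute, by symmetry of the mixed second derivatives along
  \<open>(axis i 1, 0)\<close> and \<open>(0, 1)\<close>.\<close>

lemma grad_has_vector_derivative:
  assumes "x \<in> \<Omega>" and "t \<in> T"
  shows "((\<lambda>s. grad (\<lambda>y. f y s) x $ i) has_vector_derivative
    grad (\<lambda>y. time_deriv f y t) x $ i) (at t)"
proof -
  let ?P = "\<lambda>z. frechet_derivative (\<lambda>(x, t). f x t) (at z) (axis i 1, 0)"
  let ?Q = "\<lambda>z. frechet_derivative (\<lambda>(x, t). f x t) (at z) (0, 1)"
  from temporal_slice[OF joint_differentiable(2)[OF assms]]
  have "((\<lambda>s. ?P (x, s)) has_vector_derivative frechet_derivative ?P (at (x, t)) (0, 1)) (at t)" .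
  moreover have "frechet_derivative ?P (at (x, t)) (0, 1)
      = frechet_derivative ?Q (at (x, t)) (axis i 1, 0)"
    by (rule Ck_on_2_symmetric[OF open_Times[OF open_domain] C2]) (simp add: assms)
  moreover have "\<dots> = grad (\<lambda>y. time_deriv f y t) x $ i"
    using fun_cong[OF frechet_derivative_at[OF time_deriv_has_derivative[OF assms]],
        of "axis i 1"]
    by (simp add: grad_def)
  ultimately have "((\<lambda>s. ?P (x, s)) has_vector_derivative
      grad (\<lambda>y. time_deriv f y t) x $ i) (at t)"
    by simp
  then show ?thesis
    by (rule has_vector_derivative_transform_within_open[OF _ open_domain(2) assms(2)])
      (simp add: grad_joint assms(1))
qed

end

lemma grad_differentiable:
  assumes "Ck_on 2 S f" and "x \<in> S"
  shows "grad f differentiable (at x)"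
  using assms by (intro differentiable_cartI) (simp add: grad_def numeral_2_eq_2)

text \<open>Unfolding the definitions shows the Laplacian as a sum of pure second directional
  derivatives, so exactly two orders are spent.\<close>

lemma Ck_on_laplacian:
  assumes "open S" and "Ck_on (Suc (Suc k)) S f"
  shows "Ck_on k S (laplacian f)"
proof -
  have "laplacian f = (\<lambda>x. \<Sum>i\<in>UNIV.
      frechet_derivative (\<lambda>y. frechet_derivative f (at y) (axis i 1)) (at x) (axis i 1))"
    by (simp add: fun_eq_iff laplacian_def divergence_def grad_def)
  then show ?thesis using assms(2) by (auto intro!: Ck_on_sum[OF assms(1)])
qed

section \<open>Strain\<close>

lemma grad_vec_nth:
  assumes "v differentiable (at x)"
  shows "grad (\<lambda>y. v y $ i) x $ j = frechet_derivative v (at x) (axis j 1) $ i"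
  using assms by (simp add: grad_def frechet_derivative_vec_nth)

lemma strain_vec_nth:
  "strain v x $ i $ j
   = (frechet_derivative v (at x) (axis j 1) $ i + frechet_derivative v (at x) (axis i 1) $ j) / 2"
  by (simp add: strain_def jacobian_def matrix_def transpose_def)

lemma strain_symmetric: "strain v x $ i $ j = strain v x $ j $ i"
  by (simp add: strain_vec_nth)

lemma strain_row_differentiable:
  assumes "Ck_on 2 S v" and "x \<in> S"
  shows "(\<lambda>y. strain v y $ i) differentiable (at x)"
proof (rule differentiable_cartI)
  fix j
  have "(\<lambda>y. frechet_derivative v (at y) w $ k) differentiable (at x)" for w k
    using assms by (intro differentiable_vec_nth) (simp add: numeral_2_eq_2)
  then show "(\<lambda>y. strain v y $ i $ j) differentiable (at x)"
    unfolding strain_vec_nth divide_inverse by (intro differentiable_mult differentiable_add) simp_all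
qed

text \<open>The gradient of component i is row i of the Jacobian, whose antisymmetric part contracts
  to zero against the symmetric strain. In three dimensions the entries are simply written
  out.\<close>

lemma strain_inner_grad:
  assumes "v differentiable (at x)"
  shows "(\<Sum>i\<in>UNIV. grad (\<lambda>y. v y $ i) x \<bullet> strain v x $ i) = strain v x \<bullet> strain v x"
  using assms
  by (simp add: inner_vec_def grad_vec_nth strain_vec_nth sum_3 field_simps)

text \<open>Symmetry turns the usual row-by-vector product into a combination of rows, the form that
  matches the rowwise \<open>tensor_divergence\<close>.\<close>

lemma strain_mult_vec:
  "strain v x *v w = (\<Sum>i\<in>UNIV. w $ i *\<^sub>R strain v x $ i)"
  by (simp add: vec_eq_iff matrix_vector_mult_def strain_symmetric[of v x _ i for i] mult.commute)

section \<open>Constitutive relations\<close>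

lemma density_pos:
  assumes "0 < \<rho>1" and "0 < \<rho>2"
  shows "0 < density \<rho>1 \<rho>2 c"
proof -
  have "0 \<le> cutoff c" "cutoff c \<le> 1" by (simp_all add: cutoff_def)
  then show ?thesis
    \<comment> \<open>The density is a convex combination of positive numbers. The library bound is
      a strict upper one, hence the negated densities.\<close>
    using convex_bound_lt[of "-\<rho>1" 0 "-\<rho>2" "cutoff c" "1 - cutoff c"] assms
    by (simp add: density_def mult.commute)
qed

lemma free_energy_has_derivative:
  "(free_energy \<sigma> \<epsilon> has_real_derivative
     24 * \<sigma> / \<epsilon> * (c * (1 - c) * (1 - 2 * c))) (at c)"
proof -
  have "((\<lambda>c. c\<^sup>2 * (1 - c)\<^sup>2) has_real_derivative 2 * (c * (1 - c) * (1 - 2 * c))) (at c)"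
    by (rule derivative_eq_intros refl)+ (simp add: algebra_simps power2_eq_square)
  from DERIV_cmult[OF this, of "12 * \<sigma> / \<epsilon>"] show ?thesis
    by (simp add: free_energy_def[abs_def] mult.assoc)
qed

lemma deriv_free_energy:
  "deriv (free_energy \<sigma> \<epsilon>) c = 24 * \<sigma> / \<epsilon> * (c * (1 - c) * (1 - 2 * c))"
  by (rule DERIV_imp_deriv[OF free_energy_has_derivative])

text \<open>The Laplacian uses two of the four orders; the remaining term is a cubic polynomial in
  \<open>c\<close>.\<close>

lemma Ck_on_chem_potential:
  assumes "open \<Omega>" and "Ck_on 4 \<Omega> (\<lambda>y. c y t)"
  shows "Ck_on 2 \<Omega> (\<lambda>y. chem_potential \<sigma> \<epsilon> c y t)"
proof -
  have c: "Ck_on (Suc (Suc 2)) \<Omega> (\<lambda>y. c y t)"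
    using assms(2) by (simp add: eval_nat_numeral)
  note [intro] = Ck_on_SucD[OF Ck_on_SucD[OF c]] Ck_on_laplacian[OF assms(1) c]
  \<comment> \<open>Differences are written as sums with negative coefficients, so that closure
    under constants, sums and products is enough.\<close>
  have "chem_potential \<sigma> \<epsilon> c y t =
      24 * \<sigma> / \<epsilon> * (c y t * (1 + (-1) * c y t) * (1 + (-2) * c y t))
      + (- 3/2 * \<sigma> * \<epsilon>) * laplacian (\<lambda>y. c y t) y" for y
    by (simp add: chem_potential_def deriv_free_energy)
  then show ?thesis
    by (simp only:) (intro Ck_on_add Ck_on_mult Ck_on_const assms(1); blast)
qed

section \<open>The entropy balance\<close>

text \<open>Arranges the flux into products whose divergences occur in the equations: \<mu>
  multiplies the mass flux \<open>c u\<close>, and the components of \<open>u\<close> multiply the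
  convective fluxes and the rows of the viscous stress.\<close>

lemma entropy_flux_alt:
  "entropy_flux \<sigma> \<epsilon> M0 \<rho>1 \<rho>2 \<eta>1 \<eta>2 c u p y t =
     - ((3/2 * \<sigma> * \<epsilon> * time_deriv c y t) *\<^sub>R grad (\<lambda>y. c y t) y)
     + (\<Sum>i\<in>UNIV. u y t $ i *\<^sub>R ((1/2 * density \<rho>1 \<rho>2 (c y t) * u y t $ i) *\<^sub>R u y t))
     + p y t *\<^sub>R u y t + chem_potential \<sigma> \<epsilon> c y t *\<^sub>R (c y t *\<^sub>R u y t)
     - (\<Sum>i\<in>UNIV. u y t $ i *\<^sub>R ((2 * viscosity \<eta>1 \<eta>2 (c y t)) *\<^sub>R strain (\<lambda>y. u y t) y $ i))
     - (M0 * chem_potential \<sigma> \<epsilon> c y t) *\<^sub>R grad (\<lambda>y. chem_potential \<sigma> \<epsilon> c y t) y"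
proof -
  have "(\<Sum>i\<in>UNIV. u y t $ i *\<^sub>R ((1/2 * density \<rho>1 \<rho>2 (c y t) * u y t $ i) *\<^sub>R u y t))
      = (1/2 * density \<rho>1 \<rho>2 (c y t) * (norm (u y t))\<^sup>2) *\<^sub>R u y t"
    unfolding power2_norm_eq_inner inner_vec_def sum_distrib_left scaleR_sum_left
    by (intro sum.cong) (simp_all add: mult_ac)
  moreover have "(\<Sum>i\<in>UNIV. u y t $ i *\<^sub>R ((2 * viscosity \<eta>1 \<eta>2 (c y t)) *\<^sub>R strain (\<lambda>y. u y t) y $ i))
      = (2 * viscosity \<eta>1 \<eta>2 (c y t)) *\<^sub>R (strain (\<lambda>y. u y t) y *v u y t)"
    unfolding strain_mult_vec scaleR_sum_right by (intro sum.cong) (simp_all add: mult_ac)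
  ultimately show ?thesis
    unfolding entropy_flux_def Let_def by (simp only: scaleR_add_left) (simp add: algebra_simps)
qed

theorem mainTheorem1:
  fixes \<sigma> \<epsilon> M0 \<rho>1 \<rho>2 \<eta>1 \<eta>2 c0 :: real
    and \<Omega> :: "(real^3) set" and T :: "real set"
    and c p :: "real^3 \<Rightarrow> real \<Rightarrow> real" and u :: "real^3 \<Rightarrow> real \<Rightarrow> real^3"
  assumes "\<sigma> > 0" "\<epsilon> > 0" "M0 > 0" "\<rho>1 > 0" "\<rho>2 > 0" "\<eta>1 > 0" "\<eta>2 > 0" "c0 > 0"
    and "open \<Omega>" and "open T"
    and "sufficiently_smooth \<rho>1 \<rho>2 \<Omega> T c u p"
    and "\<And>x t. x \<in> \<Omega> \<Longrightarrow> t \<in> T \<Longrightarrow> viscosity \<eta>1 \<eta>2 (c x t) \<ge> 0"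
    and "NSCH_solution \<sigma> \<epsilon> M0 \<rho>1 \<rho>2 \<eta>1 \<eta>2 c0 \<Omega> T c u p"
  shows "\<forall>x\<in>\<Omega>. \<forall>t\<in>T.
    entropy \<sigma> \<epsilon> \<rho>1 \<rho>2 c0 c u p x t \<ge> 0 \<and>
    (\<lambda>s. entropy \<sigma> \<epsilon> \<rho>1 \<rho>2 c0 c u p x s) differentiable (at t) \<and>
    (\<lambda>y. entropy_flux \<sigma> \<epsilon> M0 \<rho>1 \<rho>2 \<eta>1 \<eta>2 c u p y t) differentiable (at x) \<and>
    time_deriv (entropy \<sigma> \<epsilon> \<rho>1 \<rho>2 c0 c u p) x t
      + divergence (\<lambda>y. entropy_flux \<sigma> \<epsilon> M0 \<rho>1 \<rho>2 \<eta>1 \<eta>2 c u p y t) x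
      = entropy_production \<sigma> \<epsilon> M0 \<eta>1 \<eta>2 c u x t \<and>
    entropy_production \<sigma> \<epsilon> M0 \<eta>1 \<eta>2 c u x t \<le> 0"
proof (intro ballI)
  fix x t assume x: "x \<in> \<Omega>" and t: "t \<in> T"

  \<comment> \<open>Notation and regularity at a fixed point\<close>
  define \<mu> where "\<mu> = chem_potential \<sigma> \<epsilon> c"
  define K where "K = 3/2 * \<sigma> * \<epsilon>"
  define r where "r = (\<lambda>x t. density \<rho>1 \<rho>2 (c x t))"
  define e where "e = (\<lambda>y. viscosity \<eta>1 \<eta>2 (c y t))"
  define S where "S = strain (\<lambda>y. u y t)"
  define R where "R = max \<rho>1 \<rho>2 * c0\<^sup>2"
  define gc where "gc = grad (\<lambda>y. c y t)"
  define gm where "gm = grad (\<lambda>y. \<mu> y t)"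
  \<comment> \<open>\<open>W i\<close> is the flux in the conservative half of the convection and
    \<open>A i\<close> is row i of the viscous stress; their divergences enter component i of the
    momentum equation.\<close>
  define W where "W = (\<lambda>i y. (1/2 * r y t * u y t $ i) *\<^sub>R u y t)"
  define A where "A = (\<lambda>i y. (2 * e y) *\<^sub>R S y $ i)"
  define q where "q = time_deriv (\<lambda>y s. sqrt (r y s) *\<^sub>R u y s) x t"
  have R: "0 < R" using assms by (simp add: R_def max_def)
  have r_pos: "0 < r y s" for y s using density_pos assms by (simp add: r_def)
  note smooth = assms(11)[unfolded sufficiently_smooth_def]
  have C2: "Ck_on 2 (\<Omega> \<times> T) (\<lambda>(x, t). c x t)" and C4: "Ck_on 4 \<Omega> (\<lambda>x. c x t)"
    and U2: "Ck_on 2 \<Omega> (\<lambda>x. u x t)"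
    and dp: "(\<lambda>y. p y t) differentiable (at x)" and dpt: "(\<lambda>s. p x s) differentiable (at t)"
    and dq: "(\<lambda>s. sqrt (r x s) *\<^sub>R u x s) differentiable (at t)"
    and dW': "\<And>i. (\<lambda>y. (r y t * u y t $ i) *\<^sub>R u y t) differentiable (at x)"
    using smooth x t unfolding r_def by blast+
  have c2: "Ck_on 2 \<Omega> (\<lambda>x. c x t)"
    using Ck_on_SucD[OF Ck_on_SucD] C4 by (metis Suc_1 add_2_eq_Suc numeral_Bit0 one_add_one)
  have m2: "Ck_on 2 \<Omega> (\<lambda>y. \<mu> y t)"
    unfolding \<mu>_def by (rule Ck_on_chem_potential[OF assms(9), of c t, OF C4])
  have dc: "(\<lambda>y. c y t) differentiable (at x)" and dm: "(\<lambda>y. \<mu> y t) differentiable (at x)"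
    and du: "(\<lambda>y. u y t) differentiable (at x)"
    using c2 m2 U2 x by (simp_all add: numeral_2_eq_2)
  have dui: "(\<lambda>y. u y t $ i) differentiable (at x)" for i
    by (rule differentiable_vec_nth[OF du])
  have dgc: "gc differentiable (at x)" and dgm: "gm differentiable (at x)"
    unfolding gc_def gm_def using grad_differentiable c2 m2 x by blast+
  have dct: "(\<lambda>y. K * time_deriv c y t) differentiable (at x)"
    using time_deriv_differentiable[OF assms(9,10) C2 x t] by (intro differentiable_mult) simp_all
  have dMm: "(\<lambda>y. M0 * \<mu> y t) differentiable (at x)"
    using dm by (intro differentiable_mult) simp_all
  have dW: "W i differentiable (at x)" for i
  proof -
    have "W i = (\<lambda>y. (1/2) *\<^sub>R ((r y t * u y t $ i) *\<^sub>R u y t))" by (simp add: W_def fun_eq_iff)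
    then show ?thesis using dW' by (simp add: differentiable_scaleR del: scaleR_scaleR)
  qed
  have dA: "A i differentiable (at x)" for i
  proof -
    have "(\<lambda>y. 2 * e y) differentiable (at x)"
      unfolding e_def viscosity_def using dc
      by (intro differentiable_mult differentiable_add differentiable_diff) simp_all
    then show ?thesis
      unfolding A_def S_def using strain_row_differentiable[OF U2 x]
      by (intro differentiable_scaleR) simp_all
  qed
  have dcu: "(\<lambda>y. c y t *\<^sub>R u y t) differentiable (at x)"
    using dc du by (intro differentiable_scaleR)

  \<comment> \<open>Divergence of the entropy flux\<close>
  have flux: "(\<lambda>y. entropy_flux \<sigma> \<epsilon> M0 \<rho>1 \<rho>2 \<eta>1 \<eta>2 c u p y t)
    = (\<lambda>y. - ((K * time_deriv c y t) *\<^sub>R gc y) + (\<Sum>i\<in>UNIV. u y t $ i *\<^sub>R W i y)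
        + p y t *\<^sub>R u y t + \<mu> y t *\<^sub>R (c y t *\<^sub>R u y t)
        - (\<Sum>i\<in>UNIV. u y t $ i *\<^sub>R A i y) - (M0 * \<mu> y t) *\<^sub>R gm y)"
    unfolding entropy_flux_alt K_def gc_def gm_def W_def A_def \<mu>_def r_def e_def S_def ..
  have sums: "(\<lambda>y. \<Sum>i\<in>UNIV. u y t $ i *\<^sub>R W i y) differentiable (at x)"
    "(\<lambda>y. \<Sum>i\<in>UNIV. u y t $ i *\<^sub>R A i y) differentiable (at x)"
    using dui dW dA by (simp_all add: differentiable_sum differentiable_scaleR)
  note parts = sums differentiable_minus[OF differentiable_scaleR[OF dct dgc]]
    differentiable_scaleR[OF dp du] differentiable_scaleR[OF dm dcu]
    differentiable_scaleR[OF dMm dgm]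
  have dflux: "(\<lambda>y. entropy_flux \<sigma> \<epsilon> M0 \<rho>1 \<rho>2 \<eta>1 \<eta>2 c u p y t) differentiable (at x)"
    unfolding flux by (intro differentiable_add differentiable_diff parts)
  have gMm: "grad (\<lambda>y. M0 * \<mu> y t) x = M0 *\<^sub>R gm x"
    using dm by (simp add: grad_def gm_def vec_eq_iff frechet_derivative_mult)
  have gKct: "grad (\<lambda>y. K * time_deriv c y t) x = K *\<^sub>R grad (\<lambda>y. time_deriv c y t) x"
    using time_deriv_differentiable[OF assms(9,10) C2 x t]
    by (simp add: grad_def vec_eq_iff frechet_derivative_mult)
  have "divergence (\<lambda>y. entropy_flux \<sigma> \<epsilon> M0 \<rho>1 \<rho>2 \<eta>1 \<eta>2 c u p y t) x
    = - (K * time_deriv c x t * divergence gc x + K * (grad (\<lambda>y. time_deriv c y t) x \<bullet> gc x))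
      + (\<Sum>i\<in>UNIV. u x t $ i * divergence (W i) x + grad (\<lambda>y. u y t $ i) x \<bullet> W i x)
      + (p x t * divergence (\<lambda>y. u y t) x + grad (\<lambda>y. p y t) x \<bullet> u x t)
      + (\<mu> x t * divergence (\<lambda>y. c y t *\<^sub>R u y t) x + c x t * (gm x \<bullet> u x t))
      - (\<Sum>i\<in>UNIV. u x t $ i * divergence (A i) x + grad (\<lambda>y. u y t $ i) x \<bullet> A i x)
      - (M0 * \<mu> x t * divergence gm x + M0 * (gm x \<bullet> gm x))"
    unfolding flux
    by (simp only: divergence_add divergence_diff divergence_minus divergence_scaleR
        divergence_sum_scaleR[OF finite] differentiable_add differentiable_diff
        differentiable_scaleR parts dct dgc dui dW dA dp du dm dcu dMm dgm gMm gKct)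
      (simp add: gm_def)
  then have div: "divergence (\<lambda>y. entropy_flux \<sigma> \<epsilon> M0 \<rho>1 \<rho>2 \<eta>1 \<eta>2 c u p y t) x
    = - K * time_deriv c x t * divergence gc x - K * (grad (\<lambda>y. time_deriv c y t) x \<bullet> gc x)
      + (\<Sum>i\<in>UNIV. u x t $ i * divergence (W i) x) + (\<Sum>i\<in>UNIV. grad (\<lambda>y. u y t $ i) x \<bullet> W i x)
      + p x t * divergence (\<lambda>y. u y t) x + grad (\<lambda>y. p y t) x \<bullet> u x t
      + \<mu> x t * divergence (\<lambda>y. c y t *\<^sub>R u y t) x + c x t * (gm x \<bullet> u x t)
      - (\<Sum>i\<in>UNIV. u x t $ i * divergence (A i) x) - (\<Sum>i\<in>UNIV. grad (\<lambda>y. u y t $ i) x \<bullet> A i x)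
      - M0 * \<mu> x t * divergence gm x - M0 * (gm x \<bullet> gm x)"
    by (simp add: sum.distrib)
  have "(\<Sum>i\<in>UNIV. grad (\<lambda>y. u y t $ i) x \<bullet> A i x)
      = 2 * e x * (\<Sum>i\<in>UNIV. grad (\<lambda>y. u y t $ i) x \<bullet> S x $ i)"
    by (simp add: A_def sum_distrib_left mult_ac)
  then have dissipation: "(\<Sum>i\<in>UNIV. grad (\<lambda>y. u y t $ i) x \<bullet> A i x) = 2 * e x * (S x \<bullet> S x)"
    using strain_inner_grad[OF du] by (simp add: S_def)

  \<comment> \<open>The equations at the point, with momentum paired with velocity\<close>
  note sol = assms(13)[unfolded NSCH_solution_def Let_def, folded \<mu>_def, rule_format, OF x t]
  have mass: "time_deriv c x t + divergence (\<lambda>y. c y t *\<^sub>R u y t) x = M0 * divergence gm x"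
    using sol by (simp add: laplacian_def gm_def)
  have pressure: "time_deriv p x t + R * divergence (\<lambda>y. u y t) x = 0"
    using sol by (simp add: R_def)
  have "sqrt (r x t) *\<^sub>R q + (\<chi> i. divergence (W i) x)
      + (1/2 * r x t) *\<^sub>R (\<chi> i. u x t \<bullet> grad (\<lambda>y. u y t $ i) x) + c x t *\<^sub>R gm x
      = - grad (\<lambda>y. p y t) x + (\<chi> i. divergence (A i) x)"
    using sol by (simp add: r_def q_def W_def gm_def A_def e_def S_def tensor_divergence_def)
  from arg_cong[OF this, of "\<lambda>v. u x t \<bullet> v"]
  have "sqrt (r x t) * (u x t \<bullet> q) + u x t \<bullet> (\<chi> i. divergence (W i) x)
      + (1/2 * r x t) * (u x t \<bullet> (\<chi> i. u x t \<bullet> grad (\<lambda>y. u y t $ i) x)) + c x t * (u x t \<bullet> gm x)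
      = - (u x t \<bullet> grad (\<lambda>y. p y t) x) + u x t \<bullet> (\<chi> i. divergence (A i) x)"
    by (simp only: inner_add_right inner_minus_right inner_scaleR_right)
  \<comment> \<open>This is why the convection is split in halves: paired with \<open>u\<close>, the
    advective half gives exactly the gradient terms that, with the conservative half, complete the
    divergence of the kinetic energy flux.\<close>
  moreover have "(1/2 * r x t) * (u x t \<bullet> (\<chi> i. u x t \<bullet> grad (\<lambda>y. u y t $ i) x))
      = (\<Sum>i\<in>UNIV. grad (\<lambda>y. u y t $ i) x \<bullet> W i x)"
    unfolding inner_vec_def[of "u x t" "\<chi> i. _ i"]
    by (simp add: W_def sum_distrib_left inner_commute mult_ac)
  ultimately have momentum: "sqrt (r x t) * (u x t \<bullet> q)
      + (\<Sum>i\<in>UNIV. u x t $ i * divergence (W i) x) + (\<Sum>i\<in>UNIV. grad (\<lambda>y. u y t $ i) x \<bullet> W i x)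
      + c x t * (gm x \<bullet> u x t)
      = - (grad (\<lambda>y. p y t) x \<bullet> u x t) + (\<Sum>i\<in>UNIV. u x t $ i * divergence (A i) x)"
    by (simp add: inner_vec_def[of "u x t" "\<chi> i. _ i"] inner_commute)

  \<comment> \<open>Time derivative of the entropy\<close>
  have ct: "((\<lambda>s. c x s) has_real_derivative time_deriv c x t) (at t)"
    using time_deriv_works[OF assms(9,10) C2 x t]
    by (simp add: has_real_derivative_iff_has_vector_derivative)
  have gct: "((\<lambda>s. grad (\<lambda>y. c y s) x $ i) has_real_derivative
      grad (\<lambda>y. time_deriv c y t) x $ i) (at t)" for i
    using grad_has_vector_derivative[OF assms(9,10) C2 x t]
    by (simp add: has_real_derivative_iff_has_vector_derivative)
  have pt: "((\<lambda>s. p x s) has_real_derivative time_deriv p x t) (at t)"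
    using dpt unfolding time_deriv_def has_real_derivative_iff_has_vector_derivative
    by (simp flip: vector_derivative_works)
  have qt: "((\<lambda>s. sqrt (r x s) *\<^sub>R u x s) has_vector_derivative q) (at t)"
    using dq unfolding q_def time_deriv_def by (simp flip: vector_derivative_works)
  have d1: "((\<lambda>s. free_energy \<sigma> \<epsilon> (c x s)) has_real_derivative
      deriv (free_energy \<sigma> \<epsilon>) (c x t) * time_deriv c x t) (at t)"
    using DERIV_chain2[OF free_energy_has_derivative ct] by (simp add: deriv_free_energy)
  have norm_gc: "((\<lambda>s. \<Sum>i\<in>UNIV. (grad (\<lambda>y. c y s) x $ i)\<^sup>2) has_real_derivative
      (\<Sum>i\<in>UNIV. 2 * (grad (\<lambda>y. time_deriv c y t) x $ i * gc x $ i))) (at t)"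
    by (rule derivative_eq_intros gct refl)+ (simp add: gc_def mult_ac)
  \<comment> \<open>Differentiating the square doubles \<open>3/4\<close>, which produces the
    \<open>3/2\<close> in \<open>K\<close>.\<close>
  have d2: "((\<lambda>s. 3/4 * \<sigma> * \<epsilon> * (norm (grad (\<lambda>y. c y s) x))\<^sup>2) has_real_derivative
      K * (grad (\<lambda>y. time_deriv c y t) x \<bullet> gc x)) (at t)"
    using DERIV_cmult[OF norm_gc, of "3/4 * \<sigma> * \<epsilon>"] unfolding power2_norm_eq_inner inner_vec_def
    by (simp add: K_def power2_eq_square mult_ac flip: sum_distrib_left)
  \<comment> \<open>Positivity of the density makes the square root square back to
    \<open>r\<close>.\<close>
  have kinetic: "1/2 * r x s * (norm (u x s))\<^sup>2
      = 1/2 * ((sqrt (r x s) *\<^sub>R u x s) \<bullet> (sqrt (r x s) *\<^sub>R u x s))" for s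
    using r_pos[of x s] by (simp add: power2_norm_eq_inner)
  have "((\<lambda>s. (sqrt (r x s) *\<^sub>R u x s) \<bullet> (sqrt (r x s) *\<^sub>R u x s)) has_real_derivative
      2 * (sqrt (r x t) * (u x t \<bullet> q))) (at t)"
    using bounded_bilinear.has_vector_derivative[OF bounded_bilinear_inner qt qt]
    by (simp add: inner_commute has_real_derivative_iff_has_vector_derivative)
  from DERIV_cmult[OF this, of "1/2"] have d3: "((\<lambda>s. 1/2 * r x s * (norm (u x s))\<^sup>2) has_real_derivative
      sqrt (r x t) * (u x t \<bullet> q)) (at t)"
    unfolding kinetic by simp
  have d4: "((\<lambda>s. (p x s)\<^sup>2 / (2 * R)) has_real_derivative p x t * time_deriv p x t / R) (at t)"
    using R by (auto intro!: derivative_eq_intros pt simp: field_simps)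
  have entropy: "entropy \<sigma> \<epsilon> \<rho>1 \<rho>2 c0 c u p x s = free_energy \<sigma> \<epsilon> (c x s)
      + 3/4 * \<sigma> * \<epsilon> * (norm (grad (\<lambda>y. c y s) x))\<^sup>2 + 1/2 * r x s * (norm (u x s))\<^sup>2
      + (p x s)\<^sup>2 / (2 * R)" for s
    by (simp add: entropy_def r_def R_def mult.assoc)
  have dE: "((\<lambda>s. entropy \<sigma> \<epsilon> \<rho>1 \<rho>2 c0 c u p x s) has_real_derivative
      deriv (free_energy \<sigma> \<epsilon>) (c x t) * time_deriv c x t
      + K * (grad (\<lambda>y. time_deriv c y t) x \<bullet> gc x) + sqrt (r x t) * (u x t \<bullet> q)
      + p x t * time_deriv p x t / R) (at t)"
    unfolding entropy by (intro DERIV_add d1 d2 d3 d4)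
  then have Et: "time_deriv (entropy \<sigma> \<epsilon> \<rho>1 \<rho>2 c0 c u p) x t
      = deriv (free_energy \<sigma> \<epsilon>) (c x t) * time_deriv c x t
      + K * (grad (\<lambda>y. time_deriv c y t) x \<bullet> gc x) + sqrt (r x t) * (u x t \<bullet> q)
      + p x t * time_deriv p x t / R"
    unfolding time_deriv_def has_real_derivative_iff_has_vector_derivative
    by (simp add: vector_derivative_at)

  \<comment> \<open>Cancellation and signs\<close>
  have mu: "deriv (free_energy \<sigma> \<epsilon>) (c x t) = \<mu> x t + K * divergence gc x"
    by (simp add: \<mu>_def chem_potential_def K_def laplacian_def gc_def)
  have pressure': "time_deriv p x t = - R * divergence (\<lambda>y. u y t) x"
    using pressure by linarith
  \<comment> \<open>Artificial compressibility makes the change of the pressure energy cancel the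
    term p div u of the flux.\<close>
  have work: "p x t * time_deriv p x t / R = - p x t * divergence (\<lambda>y. u y t) x"
    unfolding pressure' using R by simp
  have prod: "entropy_production \<sigma> \<epsilon> M0 \<eta>1 \<eta>2 c u x t
      = - M0 * (gm x \<bullet> gm x) - 2 * e x * (S x \<bullet> S x)"
    by (simp add: entropy_production_def gm_def \<mu>_def e_def S_def power2_norm_eq_inner)
  have transport: "\<mu> x t * time_deriv c x t + \<mu> x t * divergence (\<lambda>y. c y t *\<^sub>R u y t) x
      = M0 * \<mu> x t * divergence gm x"
    using arg_cong[OF mass, of "(*) (\<mu> x t)"] by (simp add: algebra_simps)
  \<comment> \<open>By \<open>mu\<close>, the two terms with \<open>K\<close> in the entropy rate
    cancel those in the flux; \<open>transport\<close> removes the terms with \<mu> outside its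
    gradient, and \<open>momentum\<close> removes the inertial, convective, capillary, pressure
    gradient and viscous work terms. Only the two dissipation terms are left.\<close>
  have balance: "time_deriv (entropy \<sigma> \<epsilon> \<rho>1 \<rho>2 c0 c u p) x t
      + divergence (\<lambda>y. entropy_flux \<sigma> \<epsilon> M0 \<rho>1 \<rho>2 \<eta>1 \<eta>2 c u p y t) x
      = entropy_production \<sigma> \<epsilon> M0 \<eta>1 \<eta>2 c u x t"
    using momentum transport
    unfolding Et div dissipation prod work mu by (simp add: algebra_simps)
  have "0 \<le> entropy \<sigma> \<epsilon> \<rho>1 \<rho>2 c0 c u p x t"
    unfolding entropy free_energy_def using assms(1,2) R r_pos[of x t]
    by (intro add_nonneg_nonneg) simp_all
  moreover have "entropy_production \<sigma> \<epsilon> M0 \<eta>1 \<eta>2 c u x t \<le> 0"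
  proof -
    \<comment> \<open>The viscosity is affine in the concentration without cutoff, so its sign comes
      from the assumption on \<open>viscosity\<close>.\<close>
    have "0 \<le> M0 * (gm x \<bullet> gm x)" and "0 \<le> 2 * e x * (S x \<bullet> S x)"
      using assms(3) assms(12)[OF x t] by (simp_all add: e_def)
    then show ?thesis unfolding prod by linarith
  qed
  ultimately show "entropy \<sigma> \<epsilon> \<rho>1 \<rho>2 c0 c u p x t \<ge> 0 \<and>
    (\<lambda>s. entropy \<sigma> \<epsilon> \<rho>1 \<rho>2 c0 c u p x s) differentiable (at t) \<and>
    (\<lambda>y. entropy_flux \<sigma> \<epsilon> M0 \<rho>1 \<rho>2 \<eta>1 \<eta>2 c u p y t) differentiable (at x) \<and>
    time_deriv (entropy \<sigma> \<epsilon> \<rho>1 \<rho>2 c0 c u p) x t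
      + divergence (\<lambda>y. entropy_flux \<sigma> \<epsilon> M0 \<rho>1 \<rho>2 \<eta>1 \<eta>2 c u p y t) x
      = entropy_production \<sigma> \<epsilon> M0 \<eta>1 \<eta>2 c u x t \<and>
    entropy_production \<sigma> \<epsilon> M0 \<eta>1 \<eta>2 c u x t \<le> 0"
    using dflux balance dE
    by (auto simp: has_field_derivative_def intro: differentiableI)
qed

end
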